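(* Let $k \geq 1$ be an integer. Then there exist co-unipolar graphs $B_k$ such that $c_{\mathbf{BIP}}(B_k) = \log k$.
   Context: Logarithms are to base 2. For a class of graphs $\mathcal{P}$, a covering of a graph $G$ by graphs of class $\mathcal{P}$ is an expression $E(G) = E(G_1) \cup \dots \cup E(G_m)$ of the edge set of $G$ as the union of the edge sets of graphs $G_1, \dots, G_m$ with $G_i \in \mathcal{P}$ for all $i \in \{1, \dots, m\}$. The cover number $c_{\mathcal{P}}(G)$ is the smallest $m$ such that $G$ admits a covering by $m$ graphs of class $\mathcal{P}$. A graph $G$ is unipolar if $V(G)$ is a disjoint union $V(A) \cup V(B)$ such that $A$ is a clique and $B$ is a disjoint union of cliques ($A$ and $B$ being the subgraphs of $G$ induced by the two parts). A graph is co-unipolar if its complement is unipolar. $c_{\mathbf{BIP}}$ denotes the cover number by bipartite graphs.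
   Formalization: The equality with log k is read as equality with log k rounded up to an integer, since the cover number is an integer and log k is not one unless k is a power of 2 (for example k = 3). *)

theory Defs
  imports Complex_Main "HOL-Library.Disjoint_Sets"
begin

record 'a graph =
  verts :: "'a set"
  edges :: "'a set set"

definition all_pairs :: "'a set \<Rightarrow> 'a set set" where
  "all_pairs V = {e. e \<subseteq> V \<and> card e = 2}"

text \<open>Finite simple undirected graphs; the graph without vertices is admitted.\<close>

definition simple_graph :: "'a graph \<Rightarrow> bool" where
  "simple_graph G \<longleftrightarrow> finite (verts G) \<and> edges G \<subseteq> all_pairs (verts G)"

definition complement :: "'a graph \<Rightarrow> 'a graph" where
  "complement G = \<lparr>verts = verts G, edges = all_pairs (verts G) - edges G\<rparr>"

definition induced_subgraph :: "'a graph \<Rightarrow> 'a set \<Rightarrow> 'a graph" where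
  "induced_subgraph G S = \<lparr>verts = S, edges = {e \<in> edges G. e \<subseteq> S}\<rparr>"

definition is_clique :: "'a graph \<Rightarrow> bool" where
  "is_clique G \<longleftrightarrow> edges G = all_pairs (verts G)"

definition disjoint_union_of_cliques :: "'a graph \<Rightarrow> bool" where
  "disjoint_union_of_cliques G \<longleftrightarrow>
     (\<exists>Q. partition_on (verts G) Q \<and>
          (\<forall>C\<in>Q. is_clique (induced_subgraph G C)) \<and>
          (\<forall>e\<in>edges G. \<exists>C\<in>Q. e \<subseteq> C))"

text \<open>Either of the two parts may be empty.\<close>

definition unipolar :: "'a graph \<Rightarrow> bool" where
  "unipolar G \<longleftrightarrow>
     (\<exists>A B. A \<union> B = verts G \<and> A \<inter> B = {} \<and>
            is_clique (induced_subgraph G A) \<and>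
            disjoint_union_of_cliques (induced_subgraph G B))"

definition co_unipolar :: "'a graph \<Rightarrow> bool" where
  "co_unipolar G \<longleftrightarrow> unipolar (complement G)"

definition bipartite :: "'a graph \<Rightarrow> bool" where
  "bipartite G \<longleftrightarrow>
     (\<exists>X Y. X \<union> Y = verts G \<and> X \<inter> Y = {} \<and>
            (\<forall>e\<in>edges G. \<exists>x\<in>X. \<exists>y\<in>Y. e = {x, y}))"

definition BIP :: "'a graph set" where
  "BIP = {G. simple_graph G \<and> bipartite G}"

definition is_covering :: "'a graph set \<Rightarrow> 'a graph \<Rightarrow> 'a graph list \<Rightarrow> bool" where
  "is_covering P G Gs \<longleftrightarrow> set Gs \<subseteq> P \<and> edges G = (\<Union>H\<in>set Gs. edges H)"

text \<open>An edgeless graph is covered by the empty list, so its cover number is 0. The value is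
  unspecified if there is no covering at all; \<open>BIP_covering_exists\<close> below excludes
  this for bipartite coverings.\<close>

definition cover_number :: "'a graph set \<Rightarrow> 'a graph \<Rightarrow> nat" where
  "cover_number P G = (LEAST m. \<exists>Gs. length Gs = m \<and> is_covering P G Gs)"

lemma single_edge_in_BIP:
  assumes "card e = 2"
  shows "\<lparr>verts = e, edges = {e}\<rparr> \<in> BIP"
proof -
  obtain x y where e: "e = {x, y}" "x \<noteq> y"
    using assms by (auto simp: card_2_iff)
  have "bipartite \<lparr>verts = e, edges = {e}\<rparr>"
    unfolding bipartite_def using e by (intro exI[of _ "{x}"] exI[of _ "{y}"]) auto
  then show ?thesis
    using e by (auto simp: BIP_def simple_graph_def all_pairs_def)
qed

lemma BIP_covering_exists:
  assumes "simple_graph G"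
  shows "\<exists>Gs. is_covering BIP G Gs"
proof -
  have fin: "finite (edges G)" and two: "\<And>e. e \<in> edges G \<Longrightarrow> card e = 2"
    using assms finite_subset[of "edges G" "Pow (verts G)"]
    by (auto simp: simple_graph_def all_pairs_def)
  obtain es where es: "set es = edges G"
    using finite_list[OF fin] by blast
  have "is_covering BIP G (map (\<lambda>e. \<lparr>verts = e, edges = {e}\<rparr>) es)"
    using es two single_edge_in_BIP by (auto simp: is_covering_def)
  then show ?thesis by blast
qed

end

theory Submission
  imports Defs
begin

text \<open>
  The complete graph on \<open>k\<close> vertices serves as \<open>B\<^sub>k\<close>: its complement has no edges, so it
  is unipolar with empty clique part and with all vertices as singleton cliques.

  A covering of any graph by \<open>m\<close> bipartite graphs amounts to a proper colouring with the
  \<open>2 ^ m\<close> subsets of \<open>{0, \<dots>, m - 1}\<close> as colours: a vertex is coloured by the set of those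
  indices for which it lies on the left side of the corresponding bipartite graph, and conversely
  each index \<open>i\<close> splits the vertices into those whose colour contains \<open>i\<close> and the others
  (\<open>bipartite_covering_iff_set_colouring\<close>). The proper colourings of a complete graph are
  the injective ones, so \<open>m\<close> bipartite graphs suffice exactly when \<open>k \<le> 2 ^ m\<close>, and the
  least such \<open>m\<close> is the logarithm of \<open>k\<close>, rounded up.
\<close>

lemma set_colouring_of_bipartite_covering:
  assumes "is_covering BIP G Gs"
  obtains f where "\<And>v. f v \<subseteq> {..<length Gs}"
    and "\<And>u v. {u, v} \<in> edges G \<Longrightarrow> f u \<noteq> f v"
proof -
  have "\<forall>H\<in>set Gs. \<exists>X. \<forall>e\<in>edges H. \<exists>x\<in>X. \<exists>y. y \<notin> X \<and> e = {x, y}"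
  proof
    fix H assume "H \<in> set Gs"
    then have "bipartite H"
      using assms by (auto simp: is_covering_def BIP_def)
    then obtain X Y where XY: "X \<inter> Y = {}" "\<forall>e\<in>edges H. \<exists>x\<in>X. \<exists>y\<in>Y. e = {x, y}"
      unfolding bipartite_def by blast
    from XY(1) have "y \<notin> X" if "y \<in> Y" for y
      using that by blast
    with XY(2) show "\<exists>X. \<forall>e\<in>edges H. \<exists>x\<in>X. \<exists>y. y \<notin> X \<and> e = {x, y}"
      by meson
  qed
  then obtain X where X: "\<And>H e. H \<in> set Gs \<Longrightarrow> e \<in> edges H \<Longrightarrow> \<exists>x\<in>X H. \<exists>y. y \<notin> X H \<and> e = {x, y}"
    by metis
  define f where "f v = {i. i < length Gs \<and> v \<in> X (Gs ! i)}" for v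
  show ?thesis
  proof
    show "f v \<subseteq> {..<length Gs}" for v
      by (auto simp: f_def)
    fix u v assume "{u, v} \<in> edges G"
    then obtain H where "H \<in> set Gs" and e: "{u, v} \<in> edges H"
      using assms by (auto simp: is_covering_def)
    then obtain i where i: "i < length Gs" "H = Gs ! i"
      by (auto simp: in_set_conv_nth)
    obtain x y where "x \<in> X H" "y \<notin> X H" "{u, v} = {x, y}"
      using X[OF \<open>H \<in> set Gs\<close> e] by blast
    then have "(u \<in> X H) \<noteq> (v \<in> X H)"
      by (auto simp: doubleton_eq_iff)
    then have "(i \<in> f u) \<noteq> (i \<in> f v)"
      using i by (simp add: f_def)
    then show "f u \<noteq> f v"
      by blast
  qed
qed

lemma bipartite_covering_of_set_colouring:
  assumes G: "simple_graph G"
    and range: "\<And>v. v \<in> verts G \<Longrightarrow> f v \<subseteq> {..<m}"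
    and proper: "\<And>u v. {u, v} \<in> edges G \<Longrightarrow> f u \<noteq> f v"
  obtains Gs where "length Gs = m" and "is_covering BIP G Gs"
proof
  define E where "E i = {e \<in> edges G. \<exists>x y. e = {x, y} \<and> i \<in> f x \<and> i \<notin> f y}" for i
  define Gs where "Gs = map (\<lambda>i. \<lparr>verts = verts G, edges = E i\<rparr>) [0..<m]"
  show "length Gs = m"
    by (simp add: Gs_def)
  have endpoints: "e \<subseteq> verts G \<and> card e = 2" if "e \<in> edges G" for e
    using G that by (auto simp: simple_graph_def all_pairs_def)
  have BIP: "\<lparr>verts = verts G, edges = E i\<rparr> \<in> BIP" for i
  proof -
    have "bipartite \<lparr>verts = verts G, edges = E i\<rparr>"
      unfolding bipartite_def
    proof (intro exI conjI)
      show "\<forall>e\<in>edges \<lparr>verts = verts G, edges = E i\<rparr>.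
          \<exists>x\<in>{v \<in> verts G. i \<in> f v}. \<exists>y\<in>{v \<in> verts G. i \<notin> f v}. e = {x, y}"
      proof
        fix e assume "e \<in> edges \<lparr>verts = verts G, edges = E i\<rparr>"
        then obtain x y where "e \<in> edges G" "e = {x, y}" "i \<in> f x" "i \<notin> f y"
          by (auto simp: E_def)
        then show "\<exists>x\<in>{v \<in> verts G. i \<in> f v}. \<exists>y\<in>{v \<in> verts G. i \<notin> f v}. e = {x, y}"
          using endpoints by blast
      qed
    qed auto
    then show ?thesis
      using G by (auto simp: BIP_def simple_graph_def E_def)
  qed
  have "\<exists>i<m. e \<in> E i" if e: "e \<in> edges G" for e
  proof -
    obtain u v where uv: "e = {u, v}"
      using endpoints[OF e] by (auto simp: card_2_iff)
    then have "f u \<noteq> f v"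
      using proper e by blast
    then obtain i where i: "(i \<in> f u) \<noteq> (i \<in> f v)"
      by blast
    then have "i < m"
      using range endpoints[OF e] uv by blast
    moreover have "\<exists>x y. e = {x, y} \<and> i \<in> f x \<and> i \<notin> f y"
      using i uv insert_commute[of u v "{}"] by blast
    ultimately show ?thesis
      using e by (auto simp: E_def)
  qed
  moreover have "E i \<subseteq> edges G" for i
    by (auto simp: E_def)
  ultimately have "edges G = (\<Union>i<m. E i)"
    by blast
  then show "is_covering BIP G Gs"
    using BIP by (auto simp: is_covering_def Gs_def)
qed

text \<open>This is the theorem of Harary, Hsu and Miller that \<open>m\<close> bipartite graphs cover
  \<open>G\<close> if and only if its chromatic number is at most \<open>2 ^ m\<close>. Subsets of an
  \<open>m\<close>-element set are taken as colours, so that no binary expansions are needed.\<close>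

theorem bipartite_covering_iff_set_colouring:
  assumes "simple_graph G"
  shows "(\<exists>Gs. length Gs = m \<and> is_covering BIP G Gs) \<longleftrightarrow>
    (\<exists>f. f ` verts G \<subseteq> Pow {..<m} \<and> (\<forall>u v. {u, v} \<in> edges G \<longrightarrow> f u \<noteq> f v))"
    (is "?covering \<longleftrightarrow> ?colouring")
proof
  assume ?covering
  then obtain Gs where m: "length Gs = m" and "is_covering BIP G Gs"
    by blast
  from this(2) obtain f where "\<And>v. f v \<subseteq> {..<length Gs}"
    and "\<And>u v. {u, v} \<in> edges G \<Longrightarrow> f u \<noteq> f v"
    by (rule set_colouring_of_bipartite_covering) blast
  with m show ?colouring
    by (intro exI[of _ f]) blast
next
  assume ?colouring
  then obtain f where range: "f ` verts G \<subseteq> Pow {..<m}"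
    and proper: "\<forall>u v. {u, v} \<in> edges G \<longrightarrow> f u \<noteq> f v"
    by blast
  obtain Gs where "length Gs = m" "is_covering BIP G Gs"
    by (rule bipartite_covering_of_set_colouring[OF assms, of f m]) (use range proper in auto)
  then show ?covering
    by blast
qed

definition complete_graph :: "'a set \<Rightarrow> 'a graph" where
  "complete_graph V = \<lparr>verts = V, edges = all_pairs V\<rparr>"

lemma simple_complete_graph: "finite V \<Longrightarrow> simple_graph (complete_graph V)"
  by (simp add: simple_graph_def complete_graph_def)

lemma co_unipolar_complete_graph: "co_unipolar (complete_graph V)"
proof -
  have no_pairs: "all_pairs {} = {}" "\<And>v. all_pairs {v} = {}"
    by (auto simp: all_pairs_def subset_singleton_iff)
  have "partition_on V ((\<lambda>v. {v}) ` V)"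
    by (auto simp: partition_on_def disjoint_def)
  then have "disjoint_union_of_cliques (induced_subgraph (complement (complete_graph V)) V)"
    unfolding disjoint_union_of_cliques_def
    by (intro exI[of _ "(\<lambda>v. {v}) ` V"])
      (auto simp: is_clique_def induced_subgraph_def complement_def complete_graph_def no_pairs)
  then show ?thesis
    unfolding co_unipolar_def unipolar_def
    by (intro exI[of _ "{}"] exI[of _ V])
      (auto simp: is_clique_def induced_subgraph_def complement_def complete_graph_def no_pairs)
qed

lemma bipartite_covering_complete_graph_iff:
  assumes "finite V"
  shows "(\<exists>Gs. length Gs = m \<and> is_covering BIP (complete_graph V) Gs) \<longleftrightarrow> card V \<le> 2 ^ m"
proof -
  have "{u, v} \<in> edges (complete_graph V) \<longleftrightarrow> u \<in> V \<and> v \<in> V \<and> u \<noteq> v" for u v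
    by (cases "u = v") (simp_all add: complete_graph_def all_pairs_def)
  then have "(\<forall>u v. {u, v} \<in> edges (complete_graph V) \<longrightarrow> f u \<noteq> f v) \<longleftrightarrow> inj_on f V"
    for f :: "'a \<Rightarrow> nat set"
    unfolding inj_on_def by blast
  then have "(\<exists>Gs. length Gs = m \<and> is_covering BIP (complete_graph V) Gs) \<longleftrightarrow>
      (\<exists>f. f ` V \<subseteq> Pow {..<m} \<and> inj_on f V)"
    by (simp add: bipartite_covering_iff_set_colouring simple_complete_graph assms)
      (simp add: complete_graph_def)
  also have "\<dots> \<longleftrightarrow> card V \<le> card (Pow {..<m})"
    using inj_on_iff_card_le[OF assms, of "Pow {..<m}"] by auto
  finally show ?thesis
    by (simp add: card_Pow)
qed

theorem cover_number_BIP_complete_graph: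
  assumes "finite V" and "V \<noteq> {}"
  shows "int (cover_number BIP (complete_graph V)) = \<lceil>log 2 (card V)\<rceil>"
proof -
  have pos: "card V \<ge> 1"
    using assms by (simp add: Suc_le_eq card_gt_0_iff)
  define c where "c = nat \<lceil>log 2 (card V)\<rceil>"
  have "log 2 (card V) \<ge> 0"
    using pos by simp
  then have c: "int c = \<lceil>log 2 (card V)\<rceil>"
    by (simp add: c_def)
  have "card V \<le> 2 ^ m \<longleftrightarrow> c \<le> m" for m
  proof -
    have "card V \<le> 2 ^ m \<longleftrightarrow> real (card V) \<le> 2 ^ m"
      by (metis of_nat_le_iff of_nat_numeral of_nat_power)
    also have "\<dots> \<longleftrightarrow> log 2 (card V) \<le> real m"
      using pos by (simp add: log_le_iff powr_realpow)
    also have "\<dots> \<longleftrightarrow> int c \<le> int m"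
      unfolding c by (simp add: ceiling_le_iff)
    finally show ?thesis
      by simp
  qed
  then have "cover_number BIP (complete_graph V) = c"
    unfolding cover_number_def bipartite_covering_complete_graph_iff[OF assms(1)]
    by (intro Least_equality) auto
  with c show ?thesis
    by simp
qed

theorem theorem10:
  fixes k :: nat
  assumes "k \<ge> 1"
  shows "\<exists>B :: nat graph. simple_graph B \<and> co_unipolar B \<and>
           int (cover_number BIP B) = \<lceil>log 2 (real k)\<rceil>"
proof -
  have "int (cover_number BIP (complete_graph {..<k})) = \<lceil>log 2 (real k)\<rceil>"
    using assms cover_number_BIP_complete_graph[of "{..<k}"] by (simp add: lessThan_empty_iff)
  then show ?thesis
    by (intro exI[of _ "complete_graph {..<k}"])
      (simp add: simple_complete_graph co_unipolar_complete_graph)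
qed

end
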